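(* Let $f:\mathbb{R}\to\mathbb{R}$ be continuous with $\lim_{|x|\to\infty} f(x)/x=0$, let $k=(k(n))_{n\ge 0}$ be a real sequence with $\sum_{j=0}^\infty |k(j)|<+\infty$, let $(H(n))_{n\ge 1}$ be a real sequence, let $\xi\in\mathbb{R}$, and let $(x(n))_{n\ge 0}$ be the real sequence defined by $x(0)=\xi$ and $$x(n+1)=H(n+1)+\sum_{j=0}^n k(n-j)f(x(j)),\quad n\ge 0.$$ Suppose $H^*(n)\to\infty$ as $n\to\infty$ and that there is $\lambda\in[0,\infty]$ such that $$\lambda=\lim_{n\to\infty}\frac{H^*_-(n)}{H^*_+(n)}.$$ (i) If $\lambda\in(0,\infty)$, then $\lim_{n\to\infty}x^*_+(n)=+\infty$, $\lim_{n\to\infty}x^*_-(n)=+\infty$, and $$\lim_{n\to\infty}\frac{x^*_+(n)}{H^*_+(n)}=1,\qquad \lim_{n\to\infty}\frac{x^*_-(n)}{H^*_-(n)}=1.$$ (ii) If $\lambda=0$, then $\lim_{n\to\infty}x^*_+(n)=+\infty$ and $$\lim_{n\to\infty}\frac{x^*_+(n)}{H^*_+(n)}=1,\qquad \lim_{n\to\infty}\frac{x^*_-(n)}{H^*_+(n)}=0.$$ (iii) If $\lambda=\infty$, then $\lim_{n\to\infty}x^*_-(n)=+\infty$ and $$\lim_{n\to\infty}\frac{x^*_+(n)}{H^*_-(n)}=0,\qquad \lim_{n\to\infty}\frac{x^*_-(n)}{H^*_-(n)}=1.$$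
   Context: Notation: $H^*(n)=\max_{1\le j\le n}|H(j)|$, $H^*_+(n)=\max_{1\le j\le n}H(j)$, $H^*_-(n)=-\min_{1\le j\le n}H(j)=\max_{1\le j\le n}(-H(j))$; $x^*_+(n)=\max_{0\le j\le n}x(j)$, $x^*_-(n)=-\min_{0\le j\le n}x(j)=\max_{0\le j\le n}(-x(j))$. *)

theory Defs
  imports Complex_Main "HOL-Library.Extended_Real"
begin

text \<open>
  The forcing sequence is indexed from 1: a function on \<^typ>\<open>nat\<close> whose value at 0 is never used.
  The running extrema of \<^term>\<open>H\<close> at \<^term>\<open>n = 0\<close> are extrema over the empty set
  and carry no meaning; only their limits as \<^term>\<open>n\<close> grows are used.

  The quotient of \<open>H_star_minus\<close> by \<open>H_star_plus\<close> has its limit in the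
  extended half-line and may meet a zero denominator, so it is meant to be formed in
  \<^typ>\<open>ereal\<close>, where a positive numerator over 0 is \<^term>\<open>\<infinity> :: ereal\<close>;
  division in \<^typ>\<open>real\<close> would yield 0 there.
\<close>

definition H_star :: "(nat \<Rightarrow> real) \<Rightarrow> nat \<Rightarrow> real" where
  "H_star H n = Max ((\<lambda>j. \<bar>H j\<bar>) ` {1..n})"

definition H_star_plus :: "(nat \<Rightarrow> real) \<Rightarrow> nat \<Rightarrow> real" where
  "H_star_plus H n = Max (H ` {1..n})"

definition H_star_minus :: "(nat \<Rightarrow> real) \<Rightarrow> nat \<Rightarrow> real" where
  "H_star_minus H n = - Min (H ` {1..n})"

definition x_star_plus :: "(nat \<Rightarrow> real) \<Rightarrow> nat \<Rightarrow> real" where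
  "x_star_plus x n = Max (x ` {0..n})"

definition x_star_minus :: "(nat \<Rightarrow> real) \<Rightarrow> nat \<Rightarrow> real" where
  "x_star_minus x n = - Min (x ` {0..n})"

lemma H_star_minus_eq_Max:
  assumes "n \<ge> 1"
  shows "H_star_minus H n = Max ((\<lambda>j. - H j) ` {1..n})"
  using assms minus_Min_eq_Max[of "H ` {1..n}"]
  by (simp add: H_star_minus_def image_image)

lemma x_star_minus_eq_Max: "x_star_minus x n = Max ((\<lambda>j. - x j) ` {0..n})"
  using minus_Min_eq_Max[of "x ` {0..n}"]
  by (simp add: x_star_minus_def image_image)

end

theory Submission
  imports Defs
begin

text \<open>
  Write \<open>P\<close>, \<open>M\<close> for the running extrema \<^term>\<open>H_star_plus H\<close>, \<^term>\<open>H_star_minus H\<close> of the forcing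
  and \<open>S\<close> for \<^term>\<open>H_star H\<close>, so that \<open>S = max P M\<close>.  The solution tracks the forcing with an error
  that is small compared with \<open>S\<close>.  Indeed, sublinearity of \<^term>\<open>f\<close> gives
  \<open>\<bar>f t\<bar> \<le> C + \<epsilon> * \<bar>t\<bar>\<close> for every \<open>\<epsilon> > 0\<close>; as \<^term>\<open>k\<close> is summable, the convolution
  up to time \<open>n\<close> is at most a constant plus a small multiple of the running maximum of \<open>\<bar>x\<bar>\<close>, and
  that maximum can be absorbed, being itself at most twice \<open>S n\<close> up to a constant
  (\<open>solution_near_forcing\<close>).  Taking maxima and dividing by \<open>S\<close>, which tends to infinity,
  the running maxima of \<open>x\<close> and of \<open>-x\<close> differ from \<open>P\<close> and \<open>M\<close> by \<open>o(S)\<close>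
  (\<open>x_star_plus_asymp\<close>, \<open>x_star_minus_asymp\<close>).

  What remains concerns the forcing alone.  If the limit \<^term>\<open>lam\<close> of \<open>M / P\<close> is finite, then
  \<open>P\<close> tends to infinity and \<open>S\<close> is of the order of \<open>P\<close>, so dividing by \<open>P\<close> is as good as
  dividing by \<open>S\<close>; if \<^term>\<open>lam\<close> is positive, the same holds for \<open>M\<close>, with \<open>P / M\<close> tending
  to \<open>1 / lam\<close>.  For \<^term>\<open>lam\<close> strictly between \<open>0\<close> and \<open>\<infinity>\<close> both apply, and each of the two
  extreme values leaves one of them.
\<close>

section \<open>Solutions follow the forcing\<close>

text \<open>
  Beyond some radius the limit hypothesis gives \<open>\<bar>f t\<bar> < \<epsilon> * \<bar>t\<bar>\<close>; inside it, \<^term>\<open>f\<close> is bounded by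
  compactness, and that bound serves as \<open>C\<close>.
\<close>

lemma linear_growth_arbitrarily_small:
  fixes f :: "real \<Rightarrow> real"
  assumes cont: "continuous_on UNIV f"
    and lim: "((\<lambda>t. f t / t) \<longlongrightarrow> 0) at_infinity"
    and "\<epsilon> > 0"
  obtains C where "C \<ge> 0" "\<And>t. \<bar>f t\<bar> \<le> C + \<epsilon> * \<bar>t\<bar>"
proof -
  have "eventually (\<lambda>t. \<bar>f t / t\<bar> < \<epsilon>) at_infinity"
    using tendstoD[OF lim \<open>\<epsilon> > 0\<close>] by (simp add: dist_real_def)
  then obtain R where R: "\<And>t. \<bar>t\<bar> \<ge> R \<Longrightarrow> \<bar>f t / t\<bar> < \<epsilon>"
    unfolding eventually_at_infinity by auto
  define r where "r = max R 1"
  have "continuous_on {-r..r} (\<lambda>t. \<bar>f t\<bar>)"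
    by (intro continuous_on_rabs continuous_on_subset[OF cont]) auto
  moreover have "{-r..r} \<noteq> {}" by (auto simp: r_def)
  ultimately obtain s where s: "\<And>t. t \<in> {-r..r} \<Longrightarrow> \<bar>f t\<bar> \<le> \<bar>f s\<bar>"
    using continuous_attains_sup[of "{-r..r}" "\<lambda>t. \<bar>f t\<bar>"] compact_Icc by blast
  show thesis
  proof
    show "\<bar>f s\<bar> \<ge> 0" by simp
    fix t
    show "\<bar>f t\<bar> \<le> \<bar>f s\<bar> + \<epsilon> * \<bar>t\<bar>"
    proof (cases "\<bar>t\<bar> \<le> r")
      case True
      then have "\<bar>f t\<bar> \<le> \<bar>f s\<bar>" by (intro s) auto
      then show ?thesis using \<open>\<epsilon> > 0\<close> by (simp add: add_increasing2)
    next
      case False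
      then have "\<bar>f t / t\<bar> < \<epsilon>" "\<bar>t\<bar> > 0" using R[of t] by (auto simp: r_def)
      then have "\<bar>f t\<bar> < \<epsilon> * \<bar>t\<bar>" by (simp add: abs_divide pos_divide_less_eq)
      then show ?thesis by simp
    qed
  qed
qed

lemma abs_convolution_le:
  fixes k g :: "nat \<Rightarrow> real"
  assumes summ: "summable (\<lambda>j. \<bar>k j\<bar>)" and g: "\<And>j. j \<le> n \<Longrightarrow> \<bar>g j\<bar> \<le> B"
  shows "\<bar>\<Sum>j=0..n. k (n - j) * g j\<bar> \<le> (\<Sum>j. \<bar>k j\<bar>) * B"
proof -
  have "B \<ge> 0" using g[of 0] by auto
  have "\<bar>\<Sum>j=0..n. k (n - j) * g j\<bar> \<le> (\<Sum>j=0..n. \<bar>k (n - j)\<bar> * B)"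
    by (rule order.trans[OF sum_abs]) (auto intro!: sum_mono mult_left_mono g simp: abs_mult)
  also have "\<dots> = (\<Sum>j=0..n. \<bar>k j\<bar>) * B"
    using sum.atLeastAtMost_rev[of "\<lambda>j. \<bar>k j\<bar>" 0 n] by (simp add: sum_distrib_right)
  also have "\<dots> \<le> (\<Sum>j. \<bar>k j\<bar>) * B"
    using \<open>B \<ge> 0\<close> by (intro mult_right_mono sum_le_suminf summ) auto
  finally show ?thesis .
qed

lemma H_star_ge: "j \<in> {1..n} \<Longrightarrow> \<bar>H j\<bar> \<le> H_star H n"
  unfolding H_star_def by (intro Max_ge) auto

text \<open>
  An a priori bound.  Let \<open>K\<close> be the sum of \<open>\<bar>k j\<bar>\<close> and \<open>X\<close> the maximum of \<open>\<bar>x i\<bar>\<close> for \<open>i \<le> n\<close>.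
  The recursion bounds the deviation by \<open>K * (c + \<epsilon> * X)\<close>.  Evaluating this where the maximum
  \<open>X\<close> is attained, and using \<open>K * \<epsilon> \<le> 1/2\<close> to move \<open>X / 2\<close> to the left, bounds \<open>X\<close> by the
  forcing; this bound goes back into the deviation estimate.
\<close>

lemma solution_near_forcing:
  fixes f :: "real \<Rightarrow> real" and k H x :: "nat \<Rightarrow> real"
  assumes cont: "continuous_on UNIV f"
    and lim: "((\<lambda>t. f t / t) \<longlongrightarrow> 0) at_infinity"
    and summ: "summable (\<lambda>j. \<bar>k j\<bar>)"
    and rec: "\<And>n. x (n + 1) = H (n + 1) + (\<Sum>j=0..n. k (n - j) * f (x j))"
    and "\<eta> > 0"
  obtains C where "\<And>n j. j \<in> {1..n} \<Longrightarrow> \<bar>x j - H j\<bar> \<le> C + \<eta> * H_star H n"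
proof -
  define K where "K = (\<Sum>j. \<bar>k j\<bar>)"
  have K: "K \<ge> 0" unfolding K_def by (intro suminf_nonneg summ) auto
  \<comment> \<open>The bound \<open>1/2\<close> permits the absorption of \<open>X\<close>; the factor 2 it costs explains \<open>\<eta>/2\<close>.
      Adding 1 to \<open>K\<close> covers a vanishing kernel.\<close>
  define \<epsilon> where "\<epsilon> = min (1/2) (\<eta>/2) / (K + 1)"
  have "\<epsilon> > 0" using K \<open>\<eta> > 0\<close> by (auto simp: \<epsilon>_def)
  have "K * \<epsilon> \<le> min (1/2) (\<eta>/2)"
    using K \<open>\<eta> > 0\<close> unfolding \<epsilon>_def
    by (auto simp: divide_simps min_def)
  then have half: "K * \<epsilon> \<le> 1/2" and eta: "2 * (K * \<epsilon>) \<le> \<eta>" by auto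
  obtain c where c: "c \<ge> 0" "\<And>t. \<bar>f t\<bar> \<le> c + \<epsilon> * \<bar>t\<bar>"
    using linear_growth_arbitrarily_small[OF cont lim \<open>\<epsilon> > 0\<close>] by metis
  show thesis
  proof
    fix n j :: nat
    assume j: "j \<in> {1..n}"
    define X where "X = Max ((\<lambda>i. \<bar>x i\<bar>) ` {0..n})"
    have X: "\<bar>x i\<bar> \<le> X" if "i \<le> n" for i
      unfolding X_def using that by (intro Max_ge) auto
    have dev: "\<bar>x i - H i\<bar> \<le> K * c + K * \<epsilon> * X" if i: "i \<in> {1..n}" for i
    proof -
      obtain m where m: "i = m + 1" using i by (cases i) auto
      have "\<bar>f (x l)\<bar> \<le> c + \<epsilon> * X" if "l \<le> m" for l
      proof -
        have "\<bar>x l\<bar> \<le> X" using that i m by (intro X) auto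
        then have "\<epsilon> * \<bar>x l\<bar> \<le> \<epsilon> * X" using \<open>\<epsilon> > 0\<close> by simp
        then show ?thesis using c(2)[of "x l"] by linarith
      qed
      then have "\<bar>\<Sum>l=0..m. k (m - l) * f (x l)\<bar> \<le> K * (c + \<epsilon> * X)"
        unfolding K_def by (intro abs_convolution_le summ) auto
      then show ?thesis using rec[of m] m by (simp add: algebra_simps)
    qed
    have S0: "H_star H n \<ge> 0" using H_star_ge[OF j, of H] by linarith
    have "X \<in> (\<lambda>i. \<bar>x i\<bar>) ` {0..n}" unfolding X_def by (intro Max_in) auto
    then obtain i where i: "i \<le> n" "X = \<bar>x i\<bar>" by auto
    have X0: "X \<ge> 0" using i by simp
    have KX: "K * \<epsilon> * X \<le> X / 2" using mult_right_mono[OF half X0] by simp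
    have "X \<le> \<bar>x 0\<bar> + H_star H n + K * c + X / 2"
    proof (cases "i = 0")
      case True
      moreover have "K * c \<ge> 0" using K c(1) by simp
      ultimately show ?thesis using i X0 S0 by simp
    next
      case False
      then have "i \<in> {1..n}" using i by auto
      then show ?thesis using dev[of i] H_star_ge[of i n H] i KX by linarith
    qed
    then have XH: "X \<le> 2 * (\<bar>x 0\<bar> + H_star H n + K * c)" by (simp add: algebra_simps)
    have "K * \<epsilon> * X \<le> K * \<epsilon> * (2 * (\<bar>x 0\<bar> + H_star H n + K * c))"
      using K \<open>\<epsilon> > 0\<close> by (intro mult_left_mono XH) auto
    also have "\<dots> = 2 * (K * \<epsilon>) * (\<bar>x 0\<bar> + H_star H n + K * c)" by simp
    also have "\<dots> \<le> \<eta> * (\<bar>x 0\<bar> + H_star H n + K * c)"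
      using S0 K c(1) by (intro mult_right_mono eta) auto
    finally show "\<bar>x j - H j\<bar> \<le> (K * c + \<eta> * (\<bar>x 0\<bar> + K * c)) + \<eta> * H_star H n"
      using dev[OF j] by (simp add: algebra_simps)
  qed
qed

text \<open>
  The maximum over \<open>x\<close> includes the index 0, where there is no forcing to compare with.  Since
  \<^term>\<open>H_star_plus H n\<close> is at least \<^term>\<open>H 1\<close>, which may be negative, the initial value exceeds
  it by at most \<open>\<bar>x 0\<bar> + \<bar>H 1\<bar>\<close>.
\<close>

lemma x_star_plus_near_H_star_plus:
  assumes "n \<ge> 1" and near: "\<And>j. j \<in> {1..n} \<Longrightarrow> \<bar>x j - H j\<bar> \<le> D"
  shows "\<bar>x_star_plus x n - H_star_plus H n\<bar> \<le> D + \<bar>x 0\<bar> + \<bar>H 1\<bar>"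
proof -
  have "D \<ge> 0" using near[of 1] \<open>n \<ge> 1\<close> by auto
  have HP: "H j \<le> H_star_plus H n" if "j \<in> {1..n}" for j
    unfolding H_star_plus_def using that by (intro Max_ge) auto
  have XP: "x j \<le> x_star_plus x n" if "j \<le> n" for j
    unfolding x_star_plus_def using that by (intro Max_ge) auto
  have "x_star_plus x n \<in> x ` {0..n}" unfolding x_star_plus_def by (intro Max_in) auto
  then obtain i where i: "i \<le> n" "x_star_plus x n = x i" by auto
  have "H_star_plus H n \<in> H ` {1..n}"
    unfolding H_star_plus_def using \<open>n \<ge> 1\<close> by (intro Max_in) auto
  then obtain l where l: "l \<in> {1..n}" "H_star_plus H n = H l" by auto
  have "x i \<le> H_star_plus H n + (D + \<bar>x 0\<bar> + \<bar>H 1\<bar>)"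
  proof (cases "i = 0")
    case True
    then show ?thesis using HP[of 1] \<open>n \<ge> 1\<close> \<open>D \<ge> 0\<close> by auto
  next
    case False
    then have "i \<in> {1..n}" using i by auto
    then show ?thesis using HP[of i] near[of i] by linarith
  qed
  moreover have "H l \<le> x_star_plus x n + D"
    using XP[of l] near[of l] l by auto
  ultimately show ?thesis using i l by linarith
qed

lemma x_star_plus_asymp:
  assumes S: "filterlim (H_star H) at_top sequentially"
    and near: "\<And>\<eta>. \<eta> > 0 \<Longrightarrow> \<exists>C. \<forall>n. \<forall>j\<in>{1..n}. \<bar>x j - H j\<bar> \<le> C + \<eta> * H_star H n"
  shows "(\<lambda>n. (x_star_plus x n - H_star_plus H n) / H_star H n) \<longlonglongrightarrow> 0"
proof (rule tendstoI)
  fix e :: real assume "e > 0"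
  obtain C where C: "\<And>n j. j \<in> {1..n} \<Longrightarrow> \<bar>x j - H j\<bar> \<le> C + e / 2 * H_star H n"
    using near[of "e/2"] \<open>e > 0\<close> half_gt_zero by blast
  define B where "B = \<bar>C\<bar> + \<bar>x 0\<bar> + \<bar>H 1\<bar>"
  have "eventually (\<lambda>n. H_star H n > 2 * B / e) sequentially"
    using S by (simp add: filterlim_at_top_dense)
  moreover have "eventually (\<lambda>n. n \<ge> 1) sequentially" by (rule eventually_ge_at_top)
  ultimately show "eventually (\<lambda>n. dist ((x_star_plus x n - H_star_plus H n) / H_star H n) 0 < e) sequentially"
  proof eventually_elim
    case (elim n)
    have "2 * B / e \<ge> 0" using \<open>e > 0\<close> by (simp add: B_def)
    then have pos: "H_star H n > 0" using elim by linarith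
    have "\<bar>x_star_plus x n - H_star_plus H n\<bar> \<le> (C + e / 2 * H_star H n) + \<bar>x 0\<bar> + \<bar>H 1\<bar>"
      using elim C by (intro x_star_plus_near_H_star_plus) auto
    also have "\<dots> \<le> B + e / 2 * H_star H n" by (simp add: B_def)
    also have "\<dots> < e * H_star H n" using elim \<open>e > 0\<close> by (simp add: field_simps)
    finally show ?case using pos by (simp add: dist_real_def abs_divide pos_divide_less_eq)
  qed
qed

text \<open>
  The closeness hypothesis and \<^term>\<open>H_star H\<close> are invariant under negating both sequences, and
  this exchanges the plus and minus extrema.
\<close>

lemma x_star_minus_asymp:
  assumes S: "filterlim (H_star H) at_top sequentially"
    and near: "\<And>\<eta>. \<eta> > 0 \<Longrightarrow> \<exists>C. \<forall>n. \<forall>j\<in>{1..n}. \<bar>x j - H j\<bar> \<le> C + \<eta> * H_star H n"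
  shows "(\<lambda>n. (x_star_minus x n - H_star_minus H n) / H_star H n) \<longlonglongrightarrow> 0"
proof -
  have neg: "H_star (\<lambda>n. - H n) = H_star H" by (rule ext) (simp add: H_star_def)
  have "\<bar>- x j - - H j\<bar> = \<bar>x j - H j\<bar>" for j by simp
  then have "(\<lambda>n. (x_star_plus (\<lambda>n. - x n) n - H_star_plus (\<lambda>n. - H n) n) / H_star H n) \<longlonglongrightarrow> 0"
    using x_star_plus_asymp[of "\<lambda>n. - H n" "\<lambda>n. - x n"] S near by (simp only: neg)
  moreover have "eventually (\<lambda>n. (x_star_plus (\<lambda>n. - x n) n - H_star_plus (\<lambda>n. - H n) n) / H_star H n =
      (x_star_minus x n - H_star_minus H n) / H_star H n) sequentially"
    using eventually_ge_at_top[of 1]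
    by eventually_elim
      (simp add: x_star_minus_eq_Max H_star_minus_eq_Max x_star_plus_def H_star_plus_def)
  ultimately show ?thesis by (rule Lim_transform_eventually)
qed

section \<open>Which running extremum of the forcing dominates\<close>

lemma H_star_eq_max:
  assumes "n \<ge> 1"
  shows "H_star H n = max (H_star_plus H n) (H_star_minus H n)"
proof (rule antisym)
  have P: "H j \<le> H_star_plus H n" and M: "- H j \<le> H_star_minus H n" if "j \<in> {1..n}" for j
    using that assms unfolding H_star_plus_def H_star_minus_eq_Max[OF assms] by auto
  have "\<bar>H j\<bar> \<le> max (H_star_plus H n) (H_star_minus H n)" if "j \<in> {1..n}" for j
    using P[OF that] M[OF that] by linarith
  then show "H_star H n \<le> max (H_star_plus H n) (H_star_minus H n)"
    unfolding H_star_def using assms by (subst Max_le_iff) auto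
  have "H j \<le> H_star H n" "- H j \<le> H_star H n" if "j \<in> {1..n}" for j
    using H_star_ge[OF that, of H] by linarith+
  then have "H_star_plus H n \<le> H_star H n" and "H_star_minus H n \<le> H_star H n"
    unfolding H_star_plus_def H_star_minus_eq_Max[OF assms]
    using assms by (subst Max_le_iff; auto)+
  then show "max (H_star_plus H n) (H_star_minus H n) \<le> H_star H n" by simp
qed

text \<open>
  Since \<open>s / p\<close> converges to \<open>max 1 l\<close>, it is bounded, so errors that are \<open>o(s)\<close> are also \<open>o(p)\<close>.
  The lemma is symmetric in its use: \<open>p\<close> may be the maximum or the negated minimum of the forcing.
\<close>

lemma asymp_of_dominant:
  fixes u v p m :: "nat \<Rightarrow> real"
  assumes p: "filterlim p at_top sequentially"
    and mp: "(\<lambda>n. m n / p n) \<longlonglongrightarrow> l"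
    and s: "eventually (\<lambda>n. s n = max (p n) (m n)) sequentially"
    and u: "(\<lambda>n. (u n - p n) / s n) \<longlonglongrightarrow> 0"
    and v: "(\<lambda>n. (v n - m n) / s n) \<longlonglongrightarrow> 0"
  shows "filterlim u at_top sequentially" "(\<lambda>n. u n / p n) \<longlonglongrightarrow> 1" "(\<lambda>n. v n / p n) \<longlonglongrightarrow> l"
proof -
  have pos: "eventually (\<lambda>n. p n > 0) sequentially"
    using p by (simp add: filterlim_at_top_dense)
  have "(\<lambda>n. max 1 (m n / p n)) \<longlonglongrightarrow> max 1 l"
    by (intro tendsto_max mp tendsto_const)
  moreover have "eventually (\<lambda>n. max 1 (m n / p n) = s n / p n) sequentially"
    using pos s by eventually_elim (auto simp: max_def field_simps)
  ultimately have sp: "(\<lambda>n. s n / p n) \<longlonglongrightarrow> max 1 l"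
    by (rule Lim_transform_eventually)
  have transfer: "(\<lambda>n. w n / p n) \<longlonglongrightarrow> c"
    if w: "(\<lambda>n. (w n - q n) / s n) \<longlonglongrightarrow> 0" and q: "(\<lambda>n. q n / p n) \<longlonglongrightarrow> c" for w q c
  proof -
    have "(\<lambda>n. (w n - q n) / s n * (s n / p n) + q n / p n) \<longlonglongrightarrow> 0 * max 1 l + c"
      by (intro tendsto_add tendsto_mult w sp q)
    moreover have "eventually (\<lambda>n. (w n - q n) / s n * (s n / p n) + q n / p n = w n / p n) sequentially"
      using pos s by eventually_elim (auto simp: field_simps max_def)
    ultimately show ?thesis by (auto intro: Lim_transform_eventually)
  qed
  have "eventually (\<lambda>n. 1 = p n / p n) sequentially"
    using pos by eventually_elim simp
  then have "(\<lambda>n. p n / p n) \<longlonglongrightarrow> 1" by (rule Lim_transform_eventually[OF tendsto_const])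
  then show up: "(\<lambda>n. u n / p n) \<longlonglongrightarrow> 1" by (rule transfer[OF u])
  show "(\<lambda>n. v n / p n) \<longlonglongrightarrow> l" by (rule transfer[OF v mp])
  have "filterlim (\<lambda>n. u n / p n * p n) at_top sequentially"
    by (rule filterlim_tendsto_pos_mult_at_top[OF up _ p]) simp
  moreover have "eventually (\<lambda>n. u n / p n * p n = u n) sequentially"
    using pos by eventually_elim simp
  ultimately show "filterlim u at_top sequentially"
    by (simp cong: filterlim_cong)
qed

text \<open>
  A finite nonnegative limit excludes a nonpositive \<open>P\<close> for large \<open>n\<close>.  If \<open>P \<le> 0\<close>, then \<open>M\<close> equals
  \<^term>\<open>H_star H n\<close> and is large, so \<open>P = 0\<close> makes the extended quotient infinite, while
  \<open>P < 0\<close>, being bounded below by \<^term>\<open>H 1\<close>, makes it less than \<open>-1\<close>.  Once \<open>P > 0\<close>, an upper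
  bound on \<open>M / P\<close> makes \<open>P\<close> comparable with \<open>max P M\<close>.
\<close>

lemma plus_dominant_of_ratio_finite:
  assumes S: "filterlim (H_star H) at_top sequentially"
    and lim: "(\<lambda>n. ereal (H_star_minus H n) / ereal (H_star_plus H n)) \<longlonglongrightarrow> lam"
    and lam: "0 \<le> lam" "lam < \<infinity>"
  shows "filterlim (H_star_plus H) at_top sequentially"
    "(\<lambda>n. H_star_minus H n / H_star_plus H n) \<longlonglongrightarrow> real_of_ereal lam"
proof -
  obtain r where r: "lam = ereal r" "r \<ge> 0" using lam by (cases lam) auto
  have up: "eventually (\<lambda>n. ereal (H_star_minus H n) / ereal (H_star_plus H n) < ereal (r + 1)) sequentially"
    using order_tendstoD(2)[OF lim, of "ereal (r + 1)"] r by simp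
  have low: "eventually (\<lambda>n. ereal (H_star_minus H n) / ereal (H_star_plus H n) > ereal (- 1)) sequentially"
    using order_tendstoD(1)[OF lim, of "ereal (- 1)"] r by simp
  have big: "eventually (\<lambda>n. H_star H n > \<bar>H 1\<bar>) sequentially"
    using S by (simp add: filterlim_at_top_dense)
  have pos: "eventually (\<lambda>n. H_star_plus H n > 0 \<and> H_star H n / (r + 1) \<le> H_star_plus H n) sequentially"
    using up low big eventually_ge_at_top[of 1]
  proof eventually_elim
    case (elim n)
    define P M where "P = H_star_plus H n" and "M = H_star_minus H n"
    have mx: "H_star H n = max P M" unfolding P_def M_def using elim by (intro H_star_eq_max)
    have "H 1 \<le> P" unfolding P_def H_star_plus_def using elim by (intro Max_ge) auto
    have "P > 0"
    proof (rule ccontr)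
      assume "\<not> P > 0"
      then have "M > \<bar>H 1\<bar>" using elim mx by auto
      show False
      proof (cases "P = 0")
        case True
        moreover have "M > 0" using \<open>M > \<bar>H 1\<bar>\<close> by linarith
        ultimately have "ereal M / ereal P = \<infinity>" by (simp add: divide_ereal_def)
        then show ?thesis using elim by (simp flip: P_def M_def)
      next
        case False
        then have "P < 0" using \<open>\<not> P > 0\<close> by simp
        then have "M / P > -1" using elim by (simp flip: P_def M_def)
        then have "M < - P" using \<open>P < 0\<close> by (simp add: field_simps)
        then show ?thesis using \<open>M > \<bar>H 1\<bar>\<close> \<open>H 1 \<le> P\<close> by linarith
      qed
    qed
    then have "M / P < r + 1" using elim by (simp flip: P_def M_def)
    then have "M < (r + 1) * P" using \<open>P > 0\<close> by (simp add: field_simps)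
    moreover have "P \<le> (r + 1) * P" using \<open>P > 0\<close> r by (simp add: algebra_simps)
    ultimately have "H_star H n \<le> (r + 1) * P" using mx by simp
    then show ?case using \<open>P > 0\<close> r by (simp flip: P_def M_def add: field_simps)
  qed
  have "filterlim (\<lambda>n. H_star H n / (r + 1)) at_top sequentially"
    using r filterlim_tendsto_pos_mult_at_top[OF tendsto_const, of "1 / (r + 1)" _ _ ] S by simp
  then show "filterlim (H_star_plus H) at_top sequentially"
    by (rule filterlim_at_top_mono) (use pos in \<open>auto elim: eventually_mono\<close>)
  have "eventually (\<lambda>n. ereal (H_star_minus H n) / ereal (H_star_plus H n) =
      ereal (H_star_minus H n / H_star_plus H n)) sequentially"
    using pos by eventually_elim auto
  from Lim_transform_eventually[OF lim this]
  show "(\<lambda>n. H_star_minus H n / H_star_plus H n) \<longlonglongrightarrow> real_of_ereal lam"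
    using r by simp
qed

text \<open>
  A ratio that is eventually above some \<open>r > 0\<close> excludes \<open>P < 0\<close> by its sign, since \<open>M\<close> would then
  be positive.  The case \<open>P = 0\<close> can persist, with the extended quotient equal to
  \<open>\<infinity>\<close>; there \<open>P / M = 0\<close> is still its inverse.  Inverting the limit therefore
  covers an infinite \<^term>\<open>lam\<close> as well, with \<open>inverse \<infinity> = 0\<close>.
\<close>

lemma minus_dominant_of_ratio_pos:
  assumes S: "filterlim (H_star H) at_top sequentially"
    and lim: "(\<lambda>n. ereal (H_star_minus H n) / ereal (H_star_plus H n)) \<longlonglongrightarrow> lam"
    and lam: "0 < lam"
  shows "filterlim (H_star_minus H) at_top sequentially"
    "(\<lambda>n. H_star_plus H n / H_star_minus H n) \<longlonglongrightarrow> real_of_ereal (inverse lam)"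
proof -
  obtain r where r: "0 < ereal r" "ereal r < lam" using ereal_dense2[OF lam] by blast
  define c where "c = min 1 r"
  have c: "c > 0" "c \<le> 1" "c \<le> r" using r by (auto simp: c_def)
  have low: "eventually (\<lambda>n. ereal (H_star_minus H n) / ereal (H_star_plus H n) > ereal r) sequentially"
    using order_tendstoD(1)[OF lim r(2)] .
  have big: "eventually (\<lambda>n. H_star H n > 0) sequentially"
    using S by (simp add: filterlim_at_top_dense)
  have pos: "eventually (\<lambda>n. H_star_plus H n \<ge> 0 \<and> H_star_minus H n > 0 \<and>
      c * H_star H n \<le> H_star_minus H n) sequentially"
    using low big eventually_ge_at_top[of 1]
  proof eventually_elim
    case (elim n)
    define P M where "P = H_star_plus H n" and "M = H_star_minus H n"
    have mx: "H_star H n = max P M" unfolding P_def M_def using elim by (intro H_star_eq_max)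
    have "P \<ge> 0 \<and> M > 0 \<and> c * max P M \<le> M"
    proof (cases "P > 0")
      case True
      then have "M / P > r" using elim by (simp flip: P_def M_def)
      then have "r * P < M" using True by (simp add: field_simps)
      moreover have "c * P \<le> r * P" using True c by simp
      moreover have "c * P > 0" using True c by simp
      ultimately have M: "c * P < M" "M > 0" by linarith+
      then have "c * M \<le> M" using c by simp
      then show ?thesis using True M by (auto simp: max_def)
    next
      case False
      then have M: "M > 0" using elim mx by auto
      have "\<not> P < 0"
      proof
        assume "P < 0"
        then have "M / P > r" using elim by (simp flip: P_def M_def)
        moreover have "M / P < 0" using M \<open>P < 0\<close> by (rule divide_pos_neg)
        ultimately show False using r by simp
      qed
      then show ?thesis using False M c by (auto simp: max_def)
    qed
    then show ?case by (simp add: mx flip: P_def M_def)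
  qed
  have "filterlim (\<lambda>n. c * H_star H n) at_top sequentially"
    by (rule filterlim_tendsto_pos_mult_at_top[OF tendsto_const c(1) S])
  then show "filterlim (H_star_minus H) at_top sequentially"
    by (rule filterlim_at_top_mono) (use pos in \<open>auto elim: eventually_mono\<close>)
  have inv: "(\<lambda>n. inverse (ereal (H_star_minus H n) / ereal (H_star_plus H n))) \<longlonglongrightarrow> inverse lam"
    using lam by (intro tendsto_inverse_ereal lim eventually_mono[OF pos]) auto
  have "eventually (\<lambda>n. inverse (ereal (H_star_minus H n) / ereal (H_star_plus H n)) =
      ereal (H_star_plus H n / H_star_minus H n)) sequentially"
    using pos
  proof eventually_elim
    case (elim n)
    then show ?case
      by (cases "H_star_plus H n = 0") (auto simp: divide_ereal_def divide_inverse)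
  qed
  from Lim_transform_eventually[OF inv this]
  have "(\<lambda>n. ereal (H_star_plus H n / H_star_minus H n)) \<longlonglongrightarrow> inverse lam" .
  moreover have "inverse lam = ereal (real_of_ereal (inverse lam))"
    using lam by (cases lam) auto
  ultimately show "(\<lambda>n. H_star_plus H n / H_star_minus H n) \<longlonglongrightarrow> real_of_ereal (inverse lam)"
    by (metis lim_ereal)
qed

section \<open>Growth of the running extrema of the solution\<close>

theorem theorem7:
  fixes f :: "real \<Rightarrow> real"
    and k H x :: "nat \<Rightarrow> real"
    and \<xi> :: real
    and lam :: ereal
  assumes "continuous_on UNIV f"
    and "((\<lambda>t. f t / t) \<longlongrightarrow> 0) at_infinity"
    and "summable (\<lambda>j. \<bar>k j\<bar>)"
    and "x 0 = \<xi>"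
    and "\<And>n. x (n + 1) = H (n + 1) + (\<Sum>j=0..n. k (n - j) * f (x j))"
    and "filterlim (H_star H) at_top sequentially"
    and "0 \<le> lam"
    and "(\<lambda>n. ereal (H_star_minus H n) / ereal (H_star_plus H n)) \<longlonglongrightarrow> lam"
  shows "(0 < lam \<and> lam < \<infinity> \<longrightarrow>
            filterlim (x_star_plus x) at_top sequentially \<and>
            filterlim (x_star_minus x) at_top sequentially \<and>
            (\<lambda>n. x_star_plus x n / H_star_plus H n) \<longlonglongrightarrow> 1 \<and>
            (\<lambda>n. x_star_minus x n / H_star_minus H n) \<longlonglongrightarrow> 1) \<and>
         (lam = 0 \<longrightarrow>
            filterlim (x_star_plus x) at_top sequentially \<and>
            (\<lambda>n. x_star_plus x n / H_star_plus H n) \<longlonglongrightarrow> 1 \<and>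
            (\<lambda>n. x_star_minus x n / H_star_plus H n) \<longlonglongrightarrow> 0) \<and>
         (lam = \<infinity> \<longrightarrow>
            filterlim (x_star_minus x) at_top sequentially \<and>
            (\<lambda>n. x_star_plus x n / H_star_minus H n) \<longlonglongrightarrow> 0 \<and>
            (\<lambda>n. x_star_minus x n / H_star_minus H n) \<longlonglongrightarrow> 1)"
proof -
  have near: "\<exists>C. \<forall>n. \<forall>j\<in>{1..n}. \<bar>x j - H j\<bar> \<le> C + \<eta> * H_star H n" if "\<eta> > 0" for \<eta>
    using solution_near_forcing[OF assms(1-3) assms(5) that] by metis
  note S = assms(6) and lim = assms(8)
  note plus = x_star_plus_asymp[OF S near] and minus = x_star_minus_asymp[OF S near]
  have s: "eventually (\<lambda>n. H_star H n = max (H_star_plus H n) (H_star_minus H n)) sequentially"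
    using eventually_ge_at_top[of 1] by eventually_elim (rule H_star_eq_max)
  then have s': "eventually (\<lambda>n. H_star H n = max (H_star_minus H n) (H_star_plus H n)) sequentially"
    by (simp add: max.commute)
  have P: "filterlim (x_star_plus x) at_top sequentially"
    "(\<lambda>n. x_star_plus x n / H_star_plus H n) \<longlonglongrightarrow> 1"
    "(\<lambda>n. x_star_minus x n / H_star_plus H n) \<longlonglongrightarrow> real_of_ereal lam" if "lam < \<infinity>"
    using asymp_of_dominant[OF plus_dominant_of_ratio_finite[OF S lim assms(7) that] s plus minus]
    by auto
  have M: "filterlim (x_star_minus x) at_top sequentially"
    "(\<lambda>n. x_star_minus x n / H_star_minus H n) \<longlonglongrightarrow> 1"
    "(\<lambda>n. x_star_plus x n / H_star_minus H n) \<longlonglongrightarrow> real_of_ereal (inverse lam)" if "0 < lam"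
    using asymp_of_dominant[OF minus_dominant_of_ratio_pos[OF S lim that] s' minus plus]
    by auto
  show ?thesis using P M by auto
qed

end
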